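(* Consider a neural network with $\kappa$ layers, a target $t$, and the set-based forward propagation $\mathcal{H}_0,\mathcal{H}_1,\dots,\mathcal{H}_\kappa=\mathcal{Y}$ of an input zonotope $\mathcal{H}_0$. Let $E(t,\mathcal{Y})$ be the set-based loss and let $\mathcal{G}_k:=\nabla_{\mathcal{H}_k}E(t,\mathcal{Y})$ be the gradient set with respect to $\mathcal{H}_k$. The gradient sets $\mathcal{G}_k$ are computed in reverse order as $$\mathcal{G}_\kappa=\nabla_{\mathcal{Y}}E(t,\mathcal{Y}),\qquad \mathcal{G}_{k-1}=\begin{cases}W_k^{\top}\,\mathcal{G}_k & \text{if the $k$-th layer is linear,}\\ \mathtt{backpropEnclose}(\phi_k,\mathcal{G}_k) & \text{otherwise,}\end{cases}$$ for $k=\kappa,\kappa-1,\dots,1$.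
   Context: Zonotopes $\langle c,G\rangle=\{c+\sum_j G_{(\cdot,j)}\beta_{(j)}\mid\beta_{(j)}\in[-1,1]\}$ are handled via center $c$ and generator matrix $G$. The gradient of a scalar function $f$ with respect to a zonotope is $\nabla_{\langle c,G\rangle}f:=\langle\nabla_cf,\nabla_Gf\rangle$ (entrywise partial derivatives). For a matrix $W$, $W\langle c,G\rangle=\langle Wc,WG\rangle$ and $W\langle c,G\rangle+b=\langle Wc+b,WG\rangle$. "$+$" between zonotopes and scalar multiplication are entrywise on $(c,G)$. Projection: $\langle c,G\rangle_{(i)}=\langle c_{(i)},G_{(i,\cdot)}\rangle$; $[p]=\{1,\dots,p\}$. Network: layer $k$ has $n_{k-1}$ inputs and $n_k$ outputs and is either linear, $h\mapsto W_kh+b_k$ with $W_k\in\mathbb{R}^{n_k\times n_{k-1}}$, $b_k\in\mathbb{R}^{n_k}$, or nonlinear, applying a (monotonically increasing) activation function $\phi_k:\mathbb{R}\to\mathbb{R}$ elementwise ($n_k=n_{k-1}$). Set-based forward propagation: $\mathcal{H}_k=W_k\mathcal{H}_{k-1}+b_k$ for linear layers and $\mathcal{H}_k=\mathtt{enclose}(\phi_k,\mathcal{H}_{k-1})$ otherwise. Image enclosure: for $\mathcal{H}_{k-1}=\langle c_{k-1},G_{k-1}\rangle$ with $p$ generators, $l_{k-1}=c_{k-1}-|G_{k-1}|\mathbf{1}$, $u_{k-1}=c_{k-1}+|G_{k-1}|\mathbf{1}$, $m_{k(i)}=\frac{\phi_k(u_{k-1(i)})-\phi_k(l_{k-1(i)})}{u_{k-1(i)}-l_{k-1(i)}}$,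 and $\underline{e}_{k(i)}$, $\overline{e}_{k(i)}$ are the minimum and maximum of $\phi_k(x)-m_{k(i)}x$ over $x\in[l_{k-1(i)},u_{k-1(i)}]$; then $\mathtt{enclose}(\phi_k,\mathcal{H}_{k-1})=\langle \mathrm{diag}(m_k)c_{k-1}+\frac12(\overline{e}_k+\underline{e}_k),\ [\,\mathrm{diag}(m_k)G_{k-1}\ \ \tfrac12\mathrm{diag}(\overline{e}_k-\underline{e}_k)\,]\rangle$. The operation $\mathtt{backpropEnclose}(\phi_k,\mathcal{G}_k)$, with $\mathcal{G}_k=\langle c'_k,G'_k\rangle$, returns the set $\mathcal{G}_{k-1}$ with $p$ generators whose projection to each dimension $i\in[n_k]$ is $$m_{k(i)}\,\mathcal{G}_{k(i)}+\big(c'_{k(i)}c_{k-1(i)}+G'_{k(i,[p])}G_{k-1(i,\cdot)}^\top\big)\nabla_{\mathcal{H}_{k-1(i)}}m_{k(i)}+\tfrac12\big(c'_{k(i)}+G'_{k(i,p+i)}\big)\nabla_{\mathcal{H}_{k-1(i)}}\overline{e}_{k(i)}+\tfrac12\big(c'_{k(i)}-G'_{k(i,p+i)}\big)\nabla_{\mathcal{H}_{k-1(i)}}\underline{e}_{k(i)},$$ where in the first summand $\mathcal{G}_{k(i)}$ is to be read as $\langle c'_{k(i)},G'_{k(i,[p])}\rangle$ (first $p$ generator columns). Set-based loss: for $\mathcal{Y}=\langle c_\kappa,G_\kappa\rangle\subset\mathbb{R}^{n_\kappa}$, $E(t,\mathcal{Y})=(1-\tau)L(t,c_\kappa)+\frac{\tau}{\epsilon}\|\mathcal{Y}\|_F$,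 where $L:\mathbb{R}^{n_\kappa}\times\mathbb{R}^{n_\kappa}\to\mathbb{R}$ is a loss function, $\tau\in[0,1]$, $\epsilon>0$, and $\|\mathcal{Y}\|_F=\frac{1}{n_\kappa}\sqrt{\sum_{i,j}G_{\kappa(i,j)}^2}$.
   Formalization: The loss E(t,·) is assumed totally differentiable at 𝒴, and the slopes m and error bounds of each nonlinear layer at the projections of its input set; with mere entrywise partial derivatives the recursion can fail or the gradients may not exist. *)

theory Defs
  imports "HOL-Analysis.Analysis" "Jordan_Normal_Form.Matrix"
begin

hide_const (open) Finite_Cartesian_Product.vec Finite_Cartesian_Product.mat
hide_type (open) Finite_Cartesian_Product.vec
unbundle no vec_syntax

text \<open>
  A zonotope is represented by its center and its generator matrix; indices start at \<open>0\<close>.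
  Addition and subtraction of zonotopes are the componentwise operations on pairs.
\<close>

type_synonym zonotope = "real vec \<times> real mat"

definition carrier_zono :: "nat \<Rightarrow> nat \<Rightarrow> zonotope set" where
  "carrier_zono n p = carrier_vec n \<times> carrier_mat n p"

definition zscale :: "real \<Rightarrow> zonotope \<Rightarrow> zonotope" where
  "zscale a Z = (a \<cdot>\<^sub>v fst Z, a \<cdot>\<^sub>m snd Z)"

definition zlinear :: "real mat \<Rightarrow> zonotope \<Rightarrow> zonotope" where
  "zlinear W Z = (W *\<^sub>v fst Z, W * snd Z)"

definition zaffine :: "real mat \<Rightarrow> real vec \<Rightarrow> zonotope \<Rightarrow> zonotope" where
  "zaffine W b Z = (W *\<^sub>v fst Z + b, W * snd Z)"

definition zproj :: "zonotope \<Rightarrow> nat \<Rightarrow> zonotope" where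
  "zproj Z i = (vec 1 (\<lambda>_. fst Z $ i), mat 1 (dim_col (snd Z)) (\<lambda>(_, j). snd Z $$ (i, j)))"

definition zgrad :: "(zonotope \<Rightarrow> real) \<Rightarrow> zonotope \<Rightarrow> zonotope" where
  "zgrad f Z = (case Z of (c, G) \<Rightarrow>
     (vec (dim_vec c) (\<lambda>i. deriv (\<lambda>x. f (c |\<^sub>v i \<mapsto> x, G)) (c $ i)),
      mat (dim_row G) (dim_col G) (\<lambda>(i, j). deriv (\<lambda>x. f (c, G |\<^sub>m (i, j) \<mapsto> x)) (G $$ (i, j)))))"

text \<open>
  \<open>zgrad\<close> is meaningful only where all partial derivatives exist; \<open>has_zgrad\<close> records
  their existence together with their values.
\<close>

definition has_zgrad :: "(zonotope \<Rightarrow> real) \<Rightarrow> zonotope \<Rightarrow> zonotope \<Rightarrow> bool" where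
  "has_zgrad f Z D \<longleftrightarrow> (case Z of (c, G) \<Rightarrow>
     D \<in> carrier_vec (dim_vec c) \<times> carrier_mat (dim_row G) (dim_col G) \<and>
     (\<forall>i<dim_vec c. ((\<lambda>x. f (c |\<^sub>v i \<mapsto> x, G)) has_real_derivative fst D $ i) (at (c $ i))) \<and>
     (\<forall>i<dim_row G. \<forall>j<dim_col G.
        ((\<lambda>x. f (c, G |\<^sub>m (i, j) \<mapsto> x)) has_real_derivative snd D $$ (i, j)) (at (G $$ (i, j)))))"

definition zinner :: "zonotope \<Rightarrow> zonotope \<Rightarrow> real" where
  "zinner Z Z' = (\<Sum>i<dim_vec (fst Z). fst Z $ i * fst Z' $ i)
     + (\<Sum>i<dim_row (snd Z). \<Sum>j<dim_col (snd Z). snd Z $$ (i, j) * snd Z' $$ (i, j))"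

definition znorm :: "zonotope \<Rightarrow> real" where
  "znorm Z = sqrt (zinner Z Z)"

text \<open>
  Total (Frechet) differentiability at \<open>Z\<close> as a function of all entries of center and
  generator matrix. It is spelled out because \<open>real vec\<close> and \<open>real mat\<close> contain all dimensions
  at once and are not normed spaces.
\<close>

definition zdifferentiable :: "(zonotope \<Rightarrow> real) \<Rightarrow> zonotope \<Rightarrow> bool" where
  "zdifferentiable f Z \<longleftrightarrow> (let S = carrier_vec (dim_vec (fst Z)) \<times>
                                    carrier_mat (dim_row (snd Z)) (dim_col (snd Z)) in
     \<exists>D\<in>S. \<forall>e>0. \<exists>d>0. \<forall>X\<in>S. znorm (X - Z) < d \<longrightarrow>
       \<bar>f X - f Z - zinner D (X - Z)\<bar> \<le> e * znorm (X - Z))"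

definition zlower :: "zonotope \<Rightarrow> real vec" where
  "zlower Z = fst Z - map_mat abs (snd Z) *\<^sub>v vec (dim_col (snd Z)) (\<lambda>_. 1)"

definition zupper :: "zonotope \<Rightarrow> real vec" where
  "zupper Z = fst Z + map_mat abs (snd Z) *\<^sub>v vec (dim_col (snd Z)) (\<lambda>_. 1)"

text \<open>
  The enclosure is meant for \<open>zlower Z $ i < zupper Z $ i\<close>; for a degenerate interval the
  slope is \<open>0\<close> by the convention \<open>0 / 0 = 0\<close>. The least and greatest values in
  \<open>err_min\<close> and \<open>err_max\<close> exist in particular for continuous \<open>\<phi>\<close>.
\<close>

definition slope :: "(real \<Rightarrow> real) \<Rightarrow> zonotope \<Rightarrow> real vec" where
  "slope \<phi> Z = vec (dim_vec (fst Z)) (\<lambda>i.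
     (\<phi> (zupper Z $ i) - \<phi> (zlower Z $ i)) / (zupper Z $ i - zlower Z $ i))"

definition err_min :: "(real \<Rightarrow> real) \<Rightarrow> zonotope \<Rightarrow> real vec" where
  "err_min \<phi> Z = vec (dim_vec (fst Z)) (\<lambda>i.
     LEAST v. v \<in> (\<lambda>x. \<phi> x - slope \<phi> Z $ i * x) ` {zlower Z $ i..zupper Z $ i})"

definition err_max :: "(real \<Rightarrow> real) \<Rightarrow> zonotope \<Rightarrow> real vec" where
  "err_max \<phi> Z = vec (dim_vec (fst Z)) (\<lambda>i.
     GREATEST v. v \<in> (\<lambda>x. \<phi> x - slope \<phi> Z $ i * x) ` {zlower Z $ i..zupper Z $ i})"

definition append_cols :: "real mat \<Rightarrow> real mat \<Rightarrow> real mat" where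
  "append_cols A B = four_block_mat A B (0\<^sub>m 0 (dim_col A)) (0\<^sub>m 0 (dim_col B))"

definition enclose :: "(real \<Rightarrow> real) \<Rightarrow> zonotope \<Rightarrow> zonotope" where
  "enclose \<phi> Z = (let n = dim_vec (fst Z); M = mat_diag n (($) (slope \<phi> Z)) in
     (M *\<^sub>v fst Z + (1/2) \<cdot>\<^sub>v (err_max \<phi> Z + err_min \<phi> Z),
      append_cols (M * snd Z) ((1/2) \<cdot>\<^sub>m mat_diag n (($) (err_max \<phi> Z - err_min \<phi> Z)))))"

text \<open>
  The \<open>i\<close>-th entries of \<open>slope\<close>, \<open>err_min\<close> and \<open>err_max\<close> depend on the \<open>i\<close>-th projection only;
  this justifies differentiating them as functions of a one-dimensional zonotope.
\<close>

lemma zlower_zproj: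
  assumes "Z \<in> carrier_zono n p" "i < n"
  shows "zlower (zproj Z i) $ 0 = zlower Z $ i"
  using assms by (auto simp: carrier_zono_def zlower_def zproj_def scalar_prod_def)

lemma zupper_zproj:
  assumes "Z \<in> carrier_zono n p" "i < n"
  shows "zupper (zproj Z i) $ 0 = zupper Z $ i"
  using assms by (auto simp: carrier_zono_def zupper_def zproj_def scalar_prod_def)

lemma slope_zproj:
  assumes "Z \<in> carrier_zono n p" "i < n"
  shows "slope \<phi> (zproj Z i) $ 0 = slope \<phi> Z $ i"
  using zlower_zproj[OF assms] zupper_zproj[OF assms] assms
  by (auto simp: slope_def zproj_def carrier_zono_def)

lemma err_zproj:
  assumes "Z \<in> carrier_zono n p" "i < n"
  shows "err_min \<phi> (zproj Z i) $ 0 = err_min \<phi> Z $ i"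
    and "err_max \<phi> (zproj Z i) $ 0 = err_max \<phi> Z $ i"
  using zlower_zproj[OF assms] zupper_zproj[OF assms] slope_zproj[OF assms] assms
  by (auto simp: err_min_def err_max_def carrier_zono_def zproj_def)

definition backprop_enclose_row ::
  "(real \<Rightarrow> real) \<Rightarrow> zonotope \<Rightarrow> zonotope \<Rightarrow> nat \<Rightarrow> zonotope" where
  "backprop_enclose_row \<phi> H D i = (case (H, D) of ((c, G), (c', G')) \<Rightarrow>
     let p = dim_col G; R = zproj H i in
       zscale (slope \<phi> H $ i) (vec 1 (\<lambda>_. c' $ i), mat 1 p (\<lambda>(_, j). G' $$ (i, j)))
     + zscale (c' $ i * c $ i + (\<Sum>j<p. G' $$ (i, j) * G $$ (i, j)))
         (zgrad (\<lambda>X. slope \<phi> X $ 0) R)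
     + zscale ((1/2) * (c' $ i + G' $$ (i, p + i))) (zgrad (\<lambda>X. err_max \<phi> X $ 0) R)
     + zscale ((1/2) * (c' $ i - G' $$ (i, p + i))) (zgrad (\<lambda>X. err_min \<phi> X $ 0) R))"

text \<open>
  \<open>H\<close> is the zonotope that was enclosed in the forward pass, \<open>D\<close> the gradient set with
  respect to \<open>enclose \<phi> H\<close>.
\<close>

definition backprop_enclose :: "(real \<Rightarrow> real) \<Rightarrow> zonotope \<Rightarrow> zonotope \<Rightarrow> zonotope" where
  "backprop_enclose \<phi> H D =
     (vec (dim_vec (fst H)) (\<lambda>i. fst (backprop_enclose_row \<phi> H D i) $ 0),
      mat (dim_vec (fst H)) (dim_col (snd H))
        (\<lambda>(i, j). snd (backprop_enclose_row \<phi> H D i) $$ (0, j)))"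

datatype layer = Linear "real mat" "real vec" | Activation "real \<Rightarrow> real"

fun wf_layer :: "nat \<Rightarrow> nat \<Rightarrow> layer \<Rightarrow> bool" where
  "wf_layer n_in n_out (Linear W b) \<longleftrightarrow> W \<in> carrier_mat n_out n_in \<and> b \<in> carrier_vec n_out"
| "wf_layer n_in n_out (Activation \<phi>) \<longleftrightarrow> n_out = n_in \<and> mono \<phi>"

fun layer_forward :: "layer \<Rightarrow> zonotope \<Rightarrow> zonotope" where
  "layer_forward (Linear W b) Z = zaffine W b Z"
| "layer_forward (Activation \<phi>) Z = enclose \<phi> Z"

text \<open>\<open>propagate N j k\<close> applies the layers \<open>j + 1, \<dots>, k\<close> in this order.\<close>

definition propagate :: "(nat \<Rightarrow> layer) \<Rightarrow> nat \<Rightarrow> nat \<Rightarrow> zonotope \<Rightarrow> zonotope" where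
  "propagate N j k = fold (\<lambda>i. layer_forward (N i)) [Suc j..<Suc k]"

definition zfrobenius :: "zonotope \<Rightarrow> real" where
  "zfrobenius Z = 1 / real (dim_vec (fst Z)) *
     sqrt (\<Sum>i<dim_row (snd Z). \<Sum>j<dim_col (snd Z). (snd Z $$ (i, j))\<^sup>2)"

definition set_loss ::
  "(real vec \<Rightarrow> real vec \<Rightarrow> real) \<Rightarrow> real \<Rightarrow> real \<Rightarrow> real vec \<Rightarrow> zonotope \<Rightarrow> real" where
  "set_loss L \<tau> \<epsilon> t Y = (1 - \<tau>) * L t (fst Y) + \<tau> / \<epsilon> * zfrobenius Y"

text \<open>
  Differentiability, at the enclosed zonotope \<open>H\<close>, of the functions whose gradients occur
  in \<open>backprop_enclose \<phi> H\<close>.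
\<close>

definition enclose_differentiable :: "(real \<Rightarrow> real) \<Rightarrow> zonotope \<Rightarrow> bool" where
  "enclose_differentiable \<phi> H \<longleftrightarrow> (\<forall>i<dim_vec (fst H).
     zdifferentiable (\<lambda>X. slope \<phi> X $ 0) (zproj H i) \<and>
     zdifferentiable (\<lambda>X. err_max \<phi> X $ 0) (zproj H i) \<and>
     zdifferentiable (\<lambda>X. err_min \<phi> X $ 0) (zproj H i))"

end

theory Submission
  imports Defs "HOL-Library.Landau_Symbols"
begin

text \<open>
  The proof is the chain rule, applied layer by layer from the output. Partial derivatives do not
  compose, so the induction carries total differentiability of the loss as a function of
  \<open>H k\<close>. Spaces of zonotopes have no type of their own; differentiability is therefore
  expressed through Landau symbols along the filter \<open>zat n p Z\<close> of neighbourhoods of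
  \<open>Z\<close>. The error bounds of the enclosure of dimension \<open>i\<close> see only the
  \<open>i\<close>-th projection, so the adjoint of an activation layer acts rowwise, and each row is
  the product rule for \<open>slope * center\<close> and \<open>slope * generator\<close>, contracted with the
  incoming gradient.
\<close>

subsection \<open>First-order expansions\<close>

text \<open>
  \<open>l\<close> is the linear part already evaluated at the displacement, so no vector space
  structure on the domain is needed; \<open>r\<close> is the size of the displacement.
\<close>

definition first_order ::
  "'a filter \<Rightarrow> ('a \<Rightarrow> real) \<Rightarrow> ('a \<Rightarrow> real) \<Rightarrow> real \<Rightarrow> ('a \<Rightarrow> real) \<Rightarrow> bool" where
  "first_order F r f a l \<longleftrightarrow> l \<in> O[F](r) \<and> (\<lambda>x. f x - a - l x) \<in> o[F](r)"

lemma first_order_cong: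
  assumes "first_order F r f a l"
    and "eventually (\<lambda>x. f x = g x) F" "a = b" "eventually (\<lambda>x. l x = l' x) F"
  shows "first_order F r g b l'"
proof -
  have "eventually (\<lambda>x. f x - a - l x = g x - b - l' x) F"
    using assms(2,4) by eventually_elim (simp add: assms(3))
  from landau_o.small.in_cong[OF this] landau_o.big.in_cong[OF assms(4)] assms(1)
  show ?thesis
    unfolding first_order_def by fast
qed

lemma first_order_const [intro]: "first_order F r (\<lambda>_. a) a (\<lambda>_. 0)"
  by (simp add: first_order_def)

lemma first_order_add:
  assumes "first_order F r f a l" "first_order F r g b l'"
  shows "first_order F r (\<lambda>x. f x + g x) (a + b) (\<lambda>x. l x + l' x)"
proof -
  have "(\<lambda>x. (f x - a - l x) + (g x - b - l' x)) \<in> o[F](r)"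
    using assms by (intro sum_in_smallo(1)) (simp_all add: first_order_def)
  then show ?thesis
    using assms by (simp add: first_order_def sum_in_bigo algebra_simps)
qed

lemma first_order_cmult:
  assumes "first_order F r f a l"
  shows "first_order F r (\<lambda>x. c * f x) (c * a) (\<lambda>x. c * l x)"
proof -
  \<comment> \<open>Constant factors may be dropped from Landau symbols only if nonzero;
    \<open>c = 0\<close> leaves the zero function.\<close>
  have "(\<lambda>x. c * (f x - a - l x)) \<in> o[F](r)"
    using assms by (cases "c = 0") (auto simp: first_order_def)
  moreover have "(\<lambda>x. c * l x) \<in> O[F](r)"
    using assms by (cases "c = 0") (auto simp: first_order_def)
  ultimately show ?thesis
    by (simp add: first_order_def algebra_simps)
qed

lemma first_order_diff:
  assumes "first_order F r f a l" "first_order F r g b l'"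
  shows "first_order F r (\<lambda>x. f x - g x) (a - b) (\<lambda>x. l x - l' x)"
  using first_order_add[OF assms(1) first_order_cmult[OF assms(2), of "-1"]] by simp

lemma first_order_sum:
  assumes "\<And>i. i \<in> I \<Longrightarrow> first_order F r (f i) (a i) (l i)"
  shows "first_order F r (\<lambda>x. \<Sum>i\<in>I. f i x) (\<Sum>i\<in>I. a i) (\<lambda>x. \<Sum>i\<in>I. l i x)"
  using assms by (induction I rule: infinite_finite_induct) (auto intro: first_order_add)

text \<open>The increment is remainder plus linear part. It bounds the second-order term of the
  product rule and the displacement \<open>F X - F Z\<close> in the chain rule.\<close>

lemma first_order_increment:
  assumes "first_order F r f a l"
  shows "(\<lambda>x. f x - a) \<in> O[F](r)"
proof -
  have "(\<lambda>x. f x - a - l x) \<in> O[F](r)" "l \<in> O[F](r)"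
    using assms by (auto simp: first_order_def intro: landau_o.small_imp_big)
  from sum_in_bigo(1)[OF this] show ?thesis by simp
qed

text \<open>Rests on \<open>f g - a b = b (f - a) + a (g - b) + (f - a) (g - b)\<close>. The last
  product is o(r): since \<open>r\<close> tends to 0, the increment of \<open>f\<close> is o(1),
  while that of \<open>g\<close> is O(r).\<close>

lemma first_order_mult:
  assumes r: "(r \<longlongrightarrow> 0) F"
    and f: "first_order F r f a l" and g: "first_order F r g b l'"
  shows "first_order F r (\<lambda>x. f x * g x) (a * b) (\<lambda>x. b * l x + a * l' x)"
proof -
  have lin: "first_order F r (\<lambda>x. b * f x + a * g x) (b * a + a * b) (\<lambda>x. b * l x + a * l' x)"
    by (intro first_order_add first_order_cmult f g)
  have "r \<in> o[F](\<lambda>_. 1)"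
    using r by (intro smalloI_tendsto) auto
  then have "(\<lambda>x. f x - a) \<in> o[F](\<lambda>_. 1)"
    by (rule landau_o.big_small_trans[OF first_order_increment[OF f]])
  then have "(\<lambda>x. (f x - a) * (g x - b)) \<in> o[F](\<lambda>x. 1 * r x)"
    by (rule landau_o.small_big_mult[OF _ first_order_increment[OF g]])
  then have "(\<lambda>x. (f x - a) * (g x - b) +
      (b * f x + a * g x - (b * a + a * b) - (b * l x + a * l' x))) \<in> o[F](r)"
    using lin by (intro sum_in_smallo(1)) (simp_all add: first_order_def)
  then show ?thesis
    using lin by (simp add: first_order_def algebra_simps)
qed

subsection \<open>Total derivatives on spaces of zonotopes\<close>

text \<open>Restricted to one shape because the types contain all dimensions. The neighbourhoods are
  not punctured, so the inner map of a composition may take the value \<open>F Z\<close> at points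
  other than \<open>Z\<close>.\<close>

definition zat :: "nat \<Rightarrow> nat \<Rightarrow> zonotope \<Rightarrow> zonotope filter" where
  "zat n p Z = inf (filtercomap (\<lambda>X. znorm (X - Z)) (nhds 0)) (principal (carrier_zono n p))"

text \<open>The derivative, a linear functional, is represented through \<open>zinner\<close> by a
  zonotope of the same shape, so that it can be compared with a gradient set.\<close>

definition has_zderiv ::
  "nat \<Rightarrow> nat \<Rightarrow> (zonotope \<Rightarrow> real) \<Rightarrow> zonotope \<Rightarrow> zonotope \<Rightarrow> bool" where
  "has_zderiv n p f Z D \<longleftrightarrow> D \<in> carrier_zono n p \<and>
     first_order (zat n p Z) (\<lambda>X. znorm (X - Z)) f (f Z) (\<lambda>X. zinner D (X - Z))"

section \<open>Entries and norm estimates\<close>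

lemma zinner_carrier:
  assumes "X \<in> carrier_zono n p"
  shows "zinner X Y = (\<Sum>i<n. fst X $ i * fst Y $ i) +
    (\<Sum>i<n. \<Sum>j<p. snd X $$ (i, j) * snd Y $$ (i, j))"
  using assms by (auto simp: zinner_def carrier_zono_def)

lemma carrier_zono_minus [intro]:
  "X \<in> carrier_zono n p \<Longrightarrow> Y \<in> carrier_zono n p \<Longrightarrow> X - Y \<in> carrier_zono n p"
  by (auto simp: carrier_zono_def intro: minus_carrier_mat)

text \<open>Subtraction of vectors and matrices takes its dimensions from the subtrahend, so the
  shape of \<open>Y\<close> decides which indices are in range.\<close>

lemma index_minus_zono:
  assumes "Y \<in> carrier_zono n p" "i < n"
  shows "fst (X - Y) $ i = fst X $ i - fst Y $ i"
    and "j < p \<Longrightarrow> snd (X - Y) $$ (i, j) = snd X $$ (i, j) - snd Y $$ (i, j)"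
  using assms by (auto simp: carrier_zono_def)

lemma znorm_nonneg: "0 \<le> znorm X"
  by (auto simp: znorm_def zinner_def intro!: sum_nonneg add_nonneg_nonneg)

text \<open>Subadditivity of the square root separates center and generators; then the Euclidean
  norm is at most the sum norm. This reduces bounds on \<open>F X - F Z\<close> to entrywise
  ones.\<close>

lemma znorm_le_sum:
  assumes "X \<in> carrier_zono n p"
  shows "znorm X \<le> (\<Sum>i<n. \<bar>fst X $ i\<bar>) + (\<Sum>i<n. \<Sum>j<p. \<bar>snd X $$ (i, j)\<bar>)"
proof -
  have "znorm X = sqrt ((\<Sum>i<n. (fst X $ i)\<^sup>2) + (\<Sum>a\<in>{..<n}\<times>{..<p}. (snd X $$ a)\<^sup>2))"
    by (simp add: znorm_def zinner_carrier[OF assms] power2_eq_square sum.cartesian_product split_def)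
  also have "\<dots> \<le> L2_set (\<lambda>i. fst X $ i) {..<n} + L2_set (\<lambda>a. snd X $$ a) ({..<n}\<times>{..<p})"
    unfolding L2_set_def by (intro sqrt_add_le_add_sqrt sum_nonneg) auto
  also have "\<dots> \<le> (\<Sum>i<n. \<bar>fst X $ i\<bar>) + (\<Sum>a\<in>{..<n}\<times>{..<p}. \<bar>snd X $$ a\<bar>)"
    by (intro add_mono L2_set_le_sum_abs)
  finally show ?thesis
    by (simp add: sum.cartesian_product split_def)
qed

lemma abs_fst_le_znorm:
  assumes "X \<in> carrier_zono n p" "i < n"
  shows "\<bar>fst X $ i\<bar> \<le> znorm X"
proof -
  have "(fst X $ i)\<^sup>2 \<le> (\<Sum>i<n. (fst X $ i)\<^sup>2)"
    using assms(2) by (intro member_le_sum) auto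
  also have "\<dots> \<le> zinner X X"
    by (auto simp: zinner_carrier[OF assms(1)] power2_eq_square intro!: sum_nonneg)
  finally show ?thesis
    unfolding znorm_def by (rule real_le_rsqrt[of "\<bar>fst X $ i\<bar>", simplified])
qed

lemma abs_snd_le_znorm:
  assumes "X \<in> carrier_zono n p" "i < n" "j < p"
  shows "\<bar>snd X $$ (i, j)\<bar> \<le> znorm X"
proof -
  have "(snd X $$ (i, j))\<^sup>2 \<le> (\<Sum>a\<in>{..<n}\<times>{..<p}. (snd X $$ a)\<^sup>2)"
    using assms(2,3) by (intro member_le_sum) auto
  also have "\<dots> \<le> zinner X X"
    by (auto simp: zinner_carrier[OF assms(1)] power2_eq_square sum.cartesian_product split_def
        intro!: sum_nonneg)
  finally show ?thesis
    unfolding znorm_def by (rule real_le_rsqrt[of "\<bar>snd X $$ (i, j)\<bar>", simplified])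
qed

section \<open>Limits and Landau estimates along \<open>zat\<close>\<close>

lemma eventually_zat:
  "eventually P (zat n p Z) \<longleftrightarrow>
    (\<exists>d>0. \<forall>X\<in>carrier_zono n p. znorm (X - Z) < d \<longrightarrow> P X)"
proof
  assume "eventually P (zat n p Z)"
  then obtain Q where Q: "eventually Q (nhds 0)"
    "\<And>X. Q (znorm (X - Z)) \<Longrightarrow> X \<in> carrier_zono n p \<Longrightarrow> P X"
    by (auto simp: zat_def eventually_inf_principal eventually_filtercomap)
  then obtain d where "d > 0" "\<And>y. dist y 0 < d \<Longrightarrow> Q y"
    unfolding eventually_nhds_metric by blast
  with Q(2) show "\<exists>d>0. \<forall>X\<in>carrier_zono n p. znorm (X - Z) < d \<longrightarrow> P X"
    by (intro exI[of _ d]) (simp add: dist_real_def znorm_nonneg)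
next
  assume "\<exists>d>0. \<forall>X\<in>carrier_zono n p. znorm (X - Z) < d \<longrightarrow> P X"
  then obtain d where d: "d > 0" "\<And>X. X \<in> carrier_zono n p \<Longrightarrow> znorm (X - Z) < d \<Longrightarrow> P X"
    by blast
  have "eventually (\<lambda>y. y < d) (nhds 0)"
    using d(1) by (intro order_tendstoD(2)[OF filterlim_ident])
  then show "eventually P (zat n p Z)"
    using d(2) by (auto simp: zat_def eventually_inf_principal eventually_filtercomap)
qed

lemma eventually_zat_carrier: "eventually (\<lambda>X. X \<in> carrier_zono n p) (zat n p Z)"
  by (auto simp: eventually_zat intro: exI[of _ 1])

lemma tendsto_znorm_zat: "((\<lambda>X. znorm (X - Z)) \<longlongrightarrow> 0) (zat n p Z)"
  unfolding zat_def by (rule filterlim_mono[OF filterlim_filtercomap]) auto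

lemma filterlim_zat:
  assumes "((\<lambda>x. znorm (f x - Z)) \<longlongrightarrow> 0) F" "eventually (\<lambda>x. f x \<in> carrier_zono n p) F"
  shows "filterlim f (zat n p Z) F"
  using assms unfolding zat_def
  by (auto simp: filterlim_inf filterlim_principal filterlim_filtercomap_iff o_def)

lemma bigo_fst_zat:
  assumes "Z \<in> carrier_zono n p" "i < n"
  shows "(\<lambda>X. fst (X - Z) $ i) \<in> O[zat n p Z](\<lambda>X. znorm (X - Z))"
proof (rule landau_o.big_mono, rule eventually_mono[OF eventually_zat_carrier])
  fix X assume "X \<in> carrier_zono n p"
  then show "norm (fst (X - Z) $ i) \<le> norm (znorm (X - Z))"
    using abs_fst_le_znorm[OF carrier_zono_minus, of X n p Z i] assms
    by (simp add: znorm_nonneg del: fst_diff)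
qed

lemma bigo_snd_zat:
  assumes "Z \<in> carrier_zono n p" "i < n" "j < p"
  shows "(\<lambda>X. snd (X - Z) $$ (i, j)) \<in> O[zat n p Z](\<lambda>X. znorm (X - Z))"
proof (rule landau_o.big_mono, rule eventually_mono[OF eventually_zat_carrier])
  fix X assume "X \<in> carrier_zono n p"
  then show "norm (snd (X - Z) $$ (i, j)) \<le> norm (znorm (X - Z))"
    using abs_snd_le_znorm[OF carrier_zono_minus, of X n p Z i j] assms
    by (simp add: znorm_nonneg del: snd_diff)
qed

text \<open>A linear functional of finitely many entries is bounded; this supplies the O-part of
  \<open>first_order\<close> whenever a derivative is established.\<close>

lemma bigo_zinner_zat:
  assumes "Z \<in> carrier_zono n p" "D \<in> carrier_zono n p"
  shows "(\<lambda>X. zinner D (X - Z)) \<in> O[zat n p Z](\<lambda>X. znorm (X - Z))"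
proof -
  have cmult: "(\<lambda>X. c * h X) \<in> O[zat n p Z](r)"
    if "h \<in> O[zat n p Z](r)" for c and h r :: "zonotope \<Rightarrow> real"
    using that by (cases "c = 0") auto
  show ?thesis
    unfolding zinner_carrier[OF assms(2)]
    by (intro sum_in_bigo big_sum_in_bigo cmult bigo_fst_zat bigo_snd_zat) (auto simp: assms(1))
qed

text \<open>Bridge to the epsilon-delta form of \<open>zdifferentiable\<close>: the definition of
  small-o provides \<open>e\<close>, the filter provides \<open>d\<close>.\<close>

lemma has_zderiv_iff:
  assumes "Z \<in> carrier_zono n p"
  shows "has_zderiv n p f Z D \<longleftrightarrow> D \<in> carrier_zono n p \<and>
    (\<forall>e>0. \<exists>d>0. \<forall>X\<in>carrier_zono n p. znorm (X - Z) < d \<longrightarrow>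
      \<bar>f X - f Z - zinner D (X - Z)\<bar> \<le> e * znorm (X - Z))"
  using bigo_zinner_zat[OF assms]
  unfolding has_zderiv_def first_order_def smallo_def mem_Collect_eq eventually_zat
  by (simp add: znorm_nonneg) blast

lemma zdifferentiable_iff:
  assumes "Z \<in> carrier_zono n p"
  shows "zdifferentiable f Z \<longleftrightarrow> (\<exists>D. has_zderiv n p f Z D)"
proof -
  have "carrier_vec (dim_vec (fst Z)) \<times> carrier_mat (dim_row (snd Z)) (dim_col (snd Z))
      = carrier_zono n p"
    using assms by (auto simp: carrier_zono_def)
  then show ?thesis
    unfolding zdifferentiable_def Let_def has_zderiv_iff[OF assms] by (simp add: Bex_def)
qed

section \<open>Coordinate functions and the chain rule\<close>

lemma first_order_fst:
  assumes "Z \<in> carrier_zono n p" "i < n"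
  shows "first_order (zat n p Z) (\<lambda>X. znorm (X - Z)) (\<lambda>X. fst X $ i) (fst Z $ i)
    (\<lambda>X. fst (X - Z) $ i)"
  using bigo_fst_zat[OF assms]
  by (simp add: first_order_def index_minus_zono[OF assms] del: fst_diff)

lemma first_order_snd:
  assumes "Z \<in> carrier_zono n p" "i < n" "j < p"
  shows "first_order (zat n p Z) (\<lambda>X. znorm (X - Z)) (\<lambda>X. snd X $$ (i, j)) (snd Z $$ (i, j))
    (\<lambda>X. snd (X - Z) $$ (i, j))"
  using bigo_snd_zat[OF assms]
  by (simp add: first_order_def index_minus_zono(2)[OF assms] del: snd_diff)

text \<open>The remainder of the composition splits into the remainder of \<open>g\<close> at
  \<open>F X\<close> and the remainder of \<open>F\<close> contracted with \<open>D\<close>. The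
  derivative of \<open>F\<close> is given by one functional per entry, \<open>A i\<close> and
  \<open>B i j\<close>; \<open>EAB\<close> says that \<open>E\<close> is the adjoint of this
  derivative applied to \<open>D\<close>.\<close>

lemma has_zderiv_compose:
  assumes g: "has_zderiv m q g (F Z) D"
    and F: "\<And>X. X \<in> carrier_zono n p \<Longrightarrow> F X \<in> carrier_zono m q"
    and Z: "Z \<in> carrier_zono n p"
    and A: "\<And>i. i < m \<Longrightarrow> first_order (zat n p Z) (\<lambda>X. znorm (X - Z))
      (\<lambda>X. fst (F X) $ i) (fst (F Z) $ i) (A i)"
    and B: "\<And>i j. i < m \<Longrightarrow> j < q \<Longrightarrow> first_order (zat n p Z) (\<lambda>X. znorm (X - Z))
      (\<lambda>X. snd (F X) $$ (i, j)) (snd (F Z) $$ (i, j)) (B i j)"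
    and E: "E \<in> carrier_zono n p"
    and EAB: "\<And>X. X \<in> carrier_zono n p \<Longrightarrow> zinner E (X - Z) =
      (\<Sum>i<m. fst D $ i * A i X) + (\<Sum>i<m. \<Sum>j<q. snd D $$ (i, j) * B i j X)"
  shows "has_zderiv n p (\<lambda>X. g (F X)) Z E"
proof -
  let ?r = "\<lambda>X. znorm (X - Z)" and ?at = "zat n p Z"
  note FZ = F[OF Z]
  have D: "D \<in> carrier_zono m q" using g by (simp add: has_zderiv_def)
  \<comment> \<open>Lets errors that are small relative to \<open>F X - F Z\<close> count as small
    relative to \<open>X - Z\<close>.\<close>
  have size: "(\<lambda>X. znorm (F X - F Z)) \<in> O[?at](?r)"
  proof (rule landau_o.big_trans[OF landau_o.big_mono])
    show "(\<lambda>X. (\<Sum>i<m. \<bar>fst (F X) $ i - fst (F Z) $ i\<bar>) +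
        (\<Sum>i<m. \<Sum>j<q. \<bar>snd (F X) $$ (i, j) - snd (F Z) $$ (i, j)\<bar>)) \<in> O[?at](?r)"
      by (intro sum_in_bigo big_sum_in_bigo)
         (auto intro!: first_order_increment A B)
    show "\<forall>\<^sub>F X in ?at. norm (znorm (F X - F Z)) \<le>
        norm ((\<Sum>i<m. \<bar>fst (F X) $ i - fst (F Z) $ i\<bar>) +
        (\<Sum>i<m. \<Sum>j<q. \<bar>snd (F X) $$ (i, j) - snd (F Z) $$ (i, j)\<bar>))"
      using eventually_zat_carrier
    proof eventually_elim
      case (elim X)
      have "znorm (F X - F Z) \<le> (\<Sum>i<m. \<bar>fst (F X) $ i - fst (F Z) $ i\<bar>) +
        (\<Sum>i<m. \<Sum>j<q. \<bar>snd (F X) $$ (i, j) - snd (F Z) $$ (i, j)\<bar>)"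
        using znorm_le_sum[OF carrier_zono_minus[OF F[OF elim] FZ]]
        by (simp add: index_minus_zono[OF FZ] del: fst_diff snd_diff)
      then show ?case by (simp add: znorm_nonneg)
    qed
  qed
  have "?r \<in> o[?at](\<lambda>_. 1)"
    using tendsto_znorm_zat by (intro smalloI_tendsto) auto
  then have "((\<lambda>X. znorm (F X - F Z)) \<longlongrightarrow> 0) ?at"
    using landau_o.big_small_trans[OF size] smalloD_tendsto by fastforce
  \<comment> \<open>The limit that permits substituting \<open>F X\<close> into the expansion of
    \<open>g\<close> at \<open>F Z\<close>.\<close>
  then have lim: "filterlim F (zat m q (F Z)) ?at"
    by (rule filterlim_zat) (rule eventually_mono[OF eventually_zat_carrier[of n p] F])
  have "(\<lambda>X. g (F X) - g (F Z) - zinner D (F X - F Z)) \<in> o[?at](\<lambda>X. znorm (F X - F Z))"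
    using g landau_o.small.compose[OF _ lim] unfolding has_zderiv_def first_order_def by fast
  then have "(\<lambda>X. g (F X) - g (F Z) - zinner D (F X - F Z)) \<in> o[?at](?r)"
    using landau_o.small_big_trans size by blast
  moreover
  have "first_order ?at ?r
      (\<lambda>X. (\<Sum>i<m. fst D $ i * fst (F X) $ i) + (\<Sum>i<m. \<Sum>j<q. snd D $$ (i, j) * snd (F X) $$ (i, j)))
      ((\<Sum>i<m. fst D $ i * fst (F Z) $ i) + (\<Sum>i<m. \<Sum>j<q. snd D $$ (i, j) * snd (F Z) $$ (i, j)))
      (\<lambda>X. (\<Sum>i<m. fst D $ i * A i X) + (\<Sum>i<m. \<Sum>j<q. snd D $$ (i, j) * B i j X))"
    by (intro first_order_add first_order_sum first_order_cmult) (auto intro: A B)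
  then have "first_order ?at ?r (\<lambda>X. zinner D (F X - F Z)) 0 (\<lambda>X. zinner E (X - Z))"
    unfolding first_order_def
  proof (elim conjE, intro conjI, goal_cases)
    case 1
    then show ?case using bigo_zinner_zat[OF Z E] by blast
  next
    case 2
    \<comment> \<open>\<open>EAB\<close> and the index rules are available only for \<open>X\<close>
      of the right shape, so the two remainders are identified eventually along the filter.\<close>
    show ?case
      by (rule landau_o.small.in_cong[THEN iffD1, OF _ 2(2)],
          rule eventually_mono[OF eventually_zat_carrier[of n p]])
         (simp add: EAB zinner_carrier[OF D] index_minus_zono[OF FZ] sum_subtractf algebra_simps
           del: fst_diff snd_diff)
  qed
  \<comment> \<open>The two remainders telescope: \<open>zinner D (F X - F Z)\<close>
    cancels.\<close>
  ultimately have "(\<lambda>X. (g (F X) - g (F Z) - zinner D (F X - F Z)) +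
      (zinner D (F X - F Z) - 0 - zinner E (X - Z))) \<in> o[?at](?r)"
    unfolding first_order_def by (intro sum_in_smallo(1)) simp_all
  then have "(\<lambda>X. g (F X) - g (F Z) - zinner E (X - Z)) \<in> o[?at](?r)"
    by (simp add: algebra_simps)
  then show ?thesis
    using E bigo_zinner_zat[OF Z E] by (simp add: has_zderiv_def first_order_def)
qed


text \<open>Along a coordinate line through \<open>Z\<close>, \<open>znorm\<close> becomes the
  absolute value and \<open>zinner D\<close> multiplication by one entry of \<open>D\<close>, so the
  total estimate turns into that of a one-variable derivative.\<close>

lemma has_zderiv_imp_has_zgrad:
  assumes "has_zderiv n p f Z D" "Z \<in> carrier_zono n p"
  shows "has_zgrad f Z D"
proof -
  obtain c G where Z: "Z = (c, G)" by fastforce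
  with assms have cG: "c \<in> carrier_vec n" "G \<in> carrier_mat n p" and D: "D \<in> carrier_zono n p"
    by (auto simp: carrier_zono_def has_zderiv_def)
  have D': "dim_vec (fst D) = n" "dim_row (snd D) = n" "dim_col (snd D) = p"
    using D by (auto simp: carrier_zono_def)
  have ex: "\<exists>d>0. \<forall>X\<in>carrier_zono n p. znorm (X - Z) < d \<longrightarrow>
      \<bar>f X - f Z - zinner D (X - Z)\<bar> \<le> e * znorm (X - Z)" if "e > 0" for e
    using assms that by (simp add: has_zderiv_iff)
  \<comment> \<open>\<open>Y\<close> abstracts the coordinate lines; it is instantiated once with
    updates of the center and once with updates of the generator matrix.\<close>
  have deriv: "((\<lambda>x. f (Y x)) has_real_derivative a) (at x0)"
    if Y: "\<And>x. Y x \<in> carrier_zono n p" "Y x0 = Z"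
      and norm: "\<And>x. znorm (Y x - Z) = \<bar>x - x0\<bar>"
      and inner: "\<And>x. zinner D (Y x - Z) = a * (x - x0)" for Y a x0
    unfolding has_field_derivative_def has_derivative_at_alt
  proof (intro conjI allI impI)
    show "bounded_linear ((*) a)" by (rule bounded_linear_mult_right)
    fix e :: real assume "e > 0"
    from ex[OF this] show "\<exists>d>0. \<forall>y. norm (y - x0) < d \<longrightarrow>
        norm (f (Y y) - f (Y x0) - a * (y - x0)) \<le> e * norm (y - x0)"
      using Y norm inner by (metis real_norm_def)
  qed
  have "((\<lambda>x. f (c |\<^sub>v i \<mapsto> x, G)) has_real_derivative fst D $ i) (at (c $ i))" if i: "i < n" for i
  proof (rule deriv)
    let ?Y = "\<lambda>x. (c |\<^sub>v i \<mapsto> x, G)"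
    show Y: "?Y x \<in> carrier_zono n p" for x
      using cG by (auto simp: carrier_zono_def update_vec_def)
    show "?Y (c $ i) = Z" by (auto simp: Z update_vec_def)
    have entries: "fst (?Y x - Z) $ l = (if l = i then x - c $ i else 0)"
      "j < p \<Longrightarrow> snd (?Y x - Z) $$ (l, j) = 0" if "l < n" for x l j
      using that cG by (auto simp: Z update_vec_def)
    \<comment> \<open>Stated for every \<open>X\<close>: with \<open>D\<close> it gives the linear
      term, with \<open>?Y x - Z\<close> itself the square of the norm.\<close>
    have inner: "zinner X (?Y x - Z) = fst X $ i * (x - c $ i)" if "X \<in> carrier_zono n p" for X x
      using i by (simp add: zinner_carrier[OF that] entries if_distrib sum.delta cong: if_cong
          del: fst_diff snd_diff)
    show "zinner D (?Y x - Z) = fst D $ i * (x - c $ i)" for x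
      by (rule inner[OF D])
    show "znorm (?Y x - Z) = \<bar>x - c $ i\<bar>" for x
      unfolding znorm_def using inner[OF carrier_zono_minus[OF Y assms(2)], of x x] i
      by (simp add: entries real_sqrt_mult_self power2_eq_square[symmetric] del: fst_diff snd_diff)
  qed
  moreover
  have "((\<lambda>x. f (c, G |\<^sub>m (i, j) \<mapsto> x)) has_real_derivative snd D $$ (i, j)) (at (G $$ (i, j)))"
    if ij: "i < n" "j < p" for i j
  proof (rule deriv)
    let ?Y = "\<lambda>x. (c, G |\<^sub>m (i, j) \<mapsto> x)"
    show Y: "?Y x \<in> carrier_zono n p" for x
      using cG by (auto simp: carrier_zono_def update_mat_def)
    show "?Y (G $$ (i, j)) = Z" by (auto simp: Z update_mat_def)
    have entries: "fst (?Y x - Z) $ l = 0"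
      "k < p \<Longrightarrow> snd (?Y x - Z) $$ (l, k) = (if l = i \<and> k = j then x - G $$ (i, j) else 0)"
      if "l < n" for x l k
      using that cG by (auto simp: Z update_mat_def)
    have inner: "zinner X (?Y x - Z) = snd X $$ (i, j) * (x - G $$ (i, j))"
      if "X \<in> carrier_zono n p" for X x
    proof -
      have "(\<Sum>k<p. snd X $$ (l, k) * snd (?Y x - Z) $$ (l, k)) =
          (if l = i then snd X $$ (i, j) * (x - G $$ (i, j)) else 0)" if "l < n" for l
        using ij that
        by (cases "l = i")
          (simp_all add: entries if_distrib sum.delta cong: if_cong del: fst_diff snd_diff)
      then show ?thesis
        using ij by (simp add: zinner_carrier[OF that] entries sum.delta del: fst_diff snd_diff)
    qed
    show "zinner D (?Y x - Z) = snd D $$ (i, j) * (x - G $$ (i, j))" for x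
      by (rule inner[OF D])
    show "znorm (?Y x - Z) = \<bar>x - G $$ (i, j)\<bar>" for x
      unfolding znorm_def using inner[OF carrier_zono_minus[OF Y assms(2)], of x x] ij
      by (simp add: entries power2_eq_square[symmetric] del: fst_diff snd_diff)
  qed
  ultimately show ?thesis
    using cG D by (auto simp: has_zgrad_def Z carrier_zono_def)
qed

lemma has_zgrad_imp_zgrad_eq:
  assumes "has_zgrad f Z D"
  shows "zgrad f Z = D"
  using assms by (cases Z; cases D)
    (auto simp: has_zgrad_def zgrad_def DERIV_imp_deriv intro!: eq_vecI eq_matI)

text \<open>The entries of a total derivative are partial derivatives, hence unique; so any
  derivative found by the chain rule is the gradient.\<close>

lemma has_zderiv_imp_zgrad_eq:
  assumes "has_zderiv n p f Z D" "Z \<in> carrier_zono n p"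
  shows "zgrad f Z = D"
  by (rule has_zgrad_imp_zgrad_eq[OF has_zderiv_imp_has_zgrad[OF assms]])

subsection \<open>Linear layers\<close>

lemma zaffine_carrier:
  assumes "W \<in> carrier_mat m n" "b \<in> carrier_vec m" "X \<in> carrier_zono n p"
  shows "zaffine W b X \<in> carrier_zono m p"
  using assms by (auto simp: zaffine_def carrier_zono_def)

lemma zaffine_index:
  assumes "W \<in> carrier_mat m n" "b \<in> carrier_vec m" "X \<in> carrier_zono n p" "i < m"
  shows "fst (zaffine W b X) $ i = (\<Sum>l<n. W $$ (i, l) * fst X $ l) + b $ i"
    and "j < p \<Longrightarrow> snd (zaffine W b X) $$ (i, j) = (\<Sum>l<n. W $$ (i, l) * snd X $$ (l, j))"
  using assms by (auto simp: zaffine_def carrier_zono_def scalar_prod_def lessThan_atLeast0)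

text \<open>\<open>W\<close> acts alike on the center and on each generator column, so the adjoint
  applies the transpose to each of them; the offset \<open>b\<close> has derivative 0.\<close>

lemma has_zderiv_zaffine:
  assumes W: "W \<in> carrier_mat m n" and b: "b \<in> carrier_vec m" and Z: "Z \<in> carrier_zono n p"
    and g: "has_zderiv m p g (zaffine W b Z) D"
  shows "has_zderiv n p (\<lambda>X. g (zaffine W b X)) Z (zlinear (transpose_mat W) D)"
proof (rule has_zderiv_compose[where F = "zaffine W b"])
  have D: "D \<in> carrier_zono m p" using g by (simp add: has_zderiv_def)
  then show E: "zlinear W\<^sup>T D \<in> carrier_zono n p"
    using W by (auto simp: carrier_zono_def zlinear_def)
  show "first_order (zat n p Z) (\<lambda>X. znorm (X - Z)) (\<lambda>X. fst (zaffine W b X) $ i)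
      (fst (zaffine W b Z) $ i) (\<lambda>X. \<Sum>l<n. W $$ (i, l) * fst (X - Z) $ l)" if "i < m" for i
  proof (rule first_order_cong)
    \<comment> \<open>The summand 0 is the linear part of the constant \<open>b $ i\<close>.\<close>
    show "first_order (zat n p Z) (\<lambda>X. znorm (X - Z))
      (\<lambda>X. (\<Sum>l<n. W $$ (i, l) * fst X $ l) + b $ i) ((\<Sum>l<n. W $$ (i, l) * fst Z $ l) + b $ i)
      (\<lambda>X. (\<Sum>l<n. W $$ (i, l) * fst (X - Z) $ l) + 0)"
      by (intro first_order_add first_order_sum first_order_cmult first_order_const first_order_fst)
        (auto simp: Z)
  qed (auto simp: zaffine_index[OF W b Z that] zaffine_index[OF W b _ that]
      intro!: eventually_mono[OF eventually_zat_carrier[of n p]])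
  show "first_order (zat n p Z) (\<lambda>X. znorm (X - Z)) (\<lambda>X. snd (zaffine W b X) $$ (i, j))
      (snd (zaffine W b Z) $$ (i, j)) (\<lambda>X. \<Sum>l<n. W $$ (i, l) * snd (X - Z) $$ (l, j))"
    if "i < m" "j < p" for i j
  proof (rule first_order_cong)
    show "first_order (zat n p Z) (\<lambda>X. znorm (X - Z))
      (\<lambda>X. (\<Sum>l<n. W $$ (i, l) * snd X $$ (l, j))) (\<Sum>l<n. W $$ (i, l) * snd Z $$ (l, j))
      (\<lambda>X. (\<Sum>l<n. W $$ (i, l) * snd (X - Z) $$ (l, j)))"
      by (intro first_order_sum first_order_cmult first_order_snd) (auto simp: Z that)
  qed (auto simp: zaffine_index(2)[OF W b Z that] zaffine_index(2)[OF W b _ that]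
      intro!: eventually_mono[OF eventually_zat_carrier[of n p]])
  show "zinner (zlinear W\<^sup>T D) (X - Z) =
      (\<Sum>i<m. fst D $ i * (\<Sum>l<n. W $$ (i, l) * fst (X - Z) $ l)) +
      (\<Sum>i<m. \<Sum>j<p. snd D $$ (i, j) * (\<Sum>l<n. W $$ (i, l) * snd (X - Z) $$ (l, j)))" for X
  proof -
    have c: "fst (zlinear W\<^sup>T D) $ l = (\<Sum>i<m. W $$ (i, l) * fst D $ i)" if "l < n" for l
      using D W that by (auto simp: zlinear_def carrier_zono_def scalar_prod_def lessThan_atLeast0)
    have G: "snd (zlinear W\<^sup>T D) $$ (l, j) = (\<Sum>i<m. W $$ (i, l) * snd D $$ (i, j))"
      if "l < n" "j < p" for l j
      using D W that by (auto simp: zlinear_def carrier_zono_def scalar_prod_def lessThan_atLeast0)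
    have "(\<Sum>l<n. fst (zlinear W\<^sup>T D) $ l * fst (X - Z) $ l) =
        (\<Sum>l<n. \<Sum>i<m. fst D $ i * (W $$ (i, l) * fst (X - Z) $ l))"
      by (simp add: c sum_distrib_left sum_distrib_right mult_ac del: fst_diff)
    also have "\<dots> = (\<Sum>i<m. fst D $ i * (\<Sum>l<n. W $$ (i, l) * fst (X - Z) $ l))"
      by (subst sum.swap) (simp add: sum_distrib_left del: fst_diff)
    finally have 1: "(\<Sum>l<n. fst (zlinear W\<^sup>T D) $ l * fst (X - Z) $ l) = \<dots>" .
    have "(\<Sum>l<n. \<Sum>j<p. snd (zlinear W\<^sup>T D) $$ (l, j) * snd (X - Z) $$ (l, j)) =
        (\<Sum>l<n. \<Sum>j<p. \<Sum>i<m. snd D $$ (i, j) * (W $$ (i, l) * snd (X - Z) $$ (l, j)))"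
      by (simp add: G sum_distrib_left sum_distrib_right mult_ac del: snd_diff)
    \<comment> \<open>Three exchanges of neighbouring sums reverse the order \<open>l, j, i\<close>
      to \<open>i, j, l\<close>.\<close>
    also have "\<dots> = (\<Sum>j<p. \<Sum>l<n. \<Sum>i<m. snd D $$ (i, j) * (W $$ (i, l) * snd (X - Z) $$ (l, j)))"
      by (rule sum.swap)
    also have "\<dots> = (\<Sum>j<p. \<Sum>i<m. \<Sum>l<n. snd D $$ (i, j) * (W $$ (i, l) * snd (X - Z) $$ (l, j)))"
      by (intro sum.cong refl sum.swap)
    also have "\<dots> = (\<Sum>i<m. \<Sum>j<p. snd D $$ (i, j) * (\<Sum>l<n. W $$ (i, l) * snd (X - Z) $$ (l, j)))"
      by (subst sum.swap) (simp add: sum_distrib_left del: snd_diff)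
    finally show ?thesis
      using 1 by (simp add: zinner_carrier[OF E] del: fst_diff snd_diff)
  qed
qed (use zaffine_carrier[OF W b] Z g in blast)+


subsection \<open>Activation layers\<close>

lemma enclose_carrier:
  assumes "X \<in> carrier_zono n p"
  shows "enclose \<phi> X \<in> carrier_zono n (p + n)"
  using assms by (auto simp: enclose_def carrier_zono_def Let_def append_cols_def mat_diag_def
      err_min_def err_max_def intro!: carrier_vecI)

text \<open>A diagonal factor on the left scales rows, and the appended diagonal block gives
  dimension \<open>i\<close> its own error generator, in column \<open>p + i\<close> counted from
  0.\<close>

lemma enclose_index:
  assumes "X \<in> carrier_zono n p" "i < n"
  shows "fst (enclose \<phi> X) $ i =
      slope \<phi> X $ i * fst X $ i + (1/2) * (err_max \<phi> X $ i + err_min \<phi> X $ i)"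
    and "j < p + n \<Longrightarrow> snd (enclose \<phi> X) $$ (i, j) =
      (if j < p then slope \<phi> X $ i * snd X $$ (i, j)
       else if j = p + i then (1/2) * (err_max \<phi> X $ i - err_min \<phi> X $ i) else 0)"
proof -
  have X: "dim_vec (fst X) = n" "snd X \<in> carrier_mat n p" "dim_row (snd X) = n" "dim_col (snd X) = p"
    using assms(1) by (auto simp: carrier_zono_def)
  have dims: "dim_vec (err_min \<phi> X) = n" "dim_vec (err_max \<phi> X) = n" "dim_vec (slope \<phi> X) = n"
    by (simp_all add: err_min_def err_max_def slope_def X)
  have "(mat_diag n (($) (slope \<phi> X)) *\<^sub>v fst X) $ i = slope \<phi> X $ i * fst X $ i"
    using assms(2) X(1) by (auto simp: mat_diag_def scalar_prod_def if_distrib[of "\<lambda>y. y * _"] cong: if_cong)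
  then show "fst (enclose \<phi> X) $ i =
      slope \<phi> X $ i * fst X $ i + (1/2) * (err_max \<phi> X $ i + err_min \<phi> X $ i)"
    using assms(2) by (simp add: enclose_def Let_def X dims)
  have diag: "mat_diag n f $$ (i, k) = (if i = k then f k else 0)" "dim_row (mat_diag n f) = n"
    "dim_col (mat_diag n f) = n" if "k < n" for f :: "nat \<Rightarrow> real" and k
    using assms(2) that by (auto simp: mat_diag_def)
  show "snd (enclose \<phi> X) $$ (i, j) =
      (if j < p then slope \<phi> X $ i * snd X $$ (i, j)
       else if j = p + i then (1/2) * (err_max \<phi> X $ i - err_min \<phi> X $ i) else 0)" if "j < p + n"
    using assms(2) that
    by (auto simp: enclose_def Let_def append_cols_def mat_diag_mult_left[OF X(2)] X dims diag)
qed

lemma zproj_carrier: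
  assumes "X \<in> carrier_zono n p"
  shows "zproj X i \<in> carrier_zono 1 p"
  using assms by (auto simp: zproj_def carrier_zono_def)

text \<open>For a one-dimensional \<open>D\<close> with \<open>p\<close> generators and a
  \<open>Y\<close> with \<open>p\<close> columns this is
  \<open>zinner D (zproj Y i)\<close>.\<close>

definition zrow :: "nat \<Rightarrow> zonotope \<Rightarrow> nat \<Rightarrow> zonotope \<Rightarrow> real" where
  "zrow p D i Y = fst D $ 0 * fst Y $ i + (\<Sum>j<p. snd D $$ (0, j) * snd Y $$ (i, j))"

text \<open>Chain rule for the linear map \<open>zproj\<close>: it carries a derivative of a
  one-dimensional function over to the full zonotope.\<close>

lemma first_order_zproj:
  assumes f: "has_zderiv 1 p f (zproj Z i) D" and Z: "Z \<in> carrier_zono n p" and i: "i < n"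
  shows "first_order (zat n p Z) (\<lambda>X. znorm (X - Z)) (\<lambda>X. f (zproj X i)) (f (zproj Z i))
    (\<lambda>X. zrow p D i (X - Z))"
proof -
  \<comment> \<open>The adjoint of the projection puts \<open>D\<close> into row \<open>i\<close>
    and zeros elsewhere.\<close>
  let ?E = "(vec n (\<lambda>l. if l = i then fst D $ 0 else 0),
    mat n p (\<lambda>(l, j). if l = i then snd D $$ (0, j) else 0))"
  have E: "?E \<in> carrier_zono n p" by (simp add: carrier_zono_def)
  have inner: "zinner ?E (X - Z) = zrow p D i (X - Z)" for X
  proof -
    have "(\<Sum>l<n. \<Sum>j<p. snd ?E $$ (l, j) * snd (X - Z) $$ (l, j)) =
        (\<Sum>l<n. if l = i then \<Sum>j<p. snd D $$ (0, j) * snd (X - Z) $$ (i, j) else 0)"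
      by (intro sum.cong refl) (auto simp del: snd_diff)
    moreover have "(\<Sum>l<n. fst ?E $ l * fst (X - Z) $ l) =
        (\<Sum>l<n. if l = i then fst D $ 0 * fst (X - Z) $ i else 0)"
      by (intro sum.cong refl) (auto simp del: fst_diff)
    ultimately show ?thesis
      unfolding zinner_carrier[OF E] using i
      by (simp add: zrow_def sum.delta del: fst_diff snd_diff)
  qed
  have proj: "fst (zproj X i) $ 0 = fst X $ i" "j < p \<Longrightarrow> snd (zproj X i) $$ (0, j) = snd X $$ (i, j)"
    if "X \<in> carrier_zono n p" for X j
    using that by (auto simp: zproj_def carrier_zono_def)
  have "has_zderiv n p (\<lambda>X. f (zproj X i)) Z ?E"
  proof (rule has_zderiv_compose[where F = "\<lambda>X. zproj X i", OF f zproj_carrier Z _ _ E])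
    show "first_order (zat n p Z) (\<lambda>X. znorm (X - Z)) (\<lambda>X. fst (zproj X i) $ k)
        (fst (zproj Z i) $ k) (\<lambda>X. fst (X - Z) $ i)" if "k < 1" for k
      by (rule first_order_cong[OF first_order_fst[OF Z i]])
         (use that in \<open>auto simp: proj Z intro!: eventually_mono[OF eventually_zat_carrier[of n p]]\<close>)
    show "first_order (zat n p Z) (\<lambda>X. znorm (X - Z)) (\<lambda>X. snd (zproj X i) $$ (k, j))
        (snd (zproj Z i) $$ (k, j)) (\<lambda>X. snd (X - Z) $$ (i, j))" if "k < 1" "j < p" for k j
      by (rule first_order_cong[OF first_order_snd[OF Z i that(2)]])
         (use that in \<open>auto simp: proj Z intro!: eventually_mono[OF eventually_zat_carrier[of n p]]\<close>)
  qed (simp_all add: inner zrow_def del: fst_diff snd_diff)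
  then show ?thesis
    by (simp add: has_zderiv_def inner del: fst_diff snd_diff)
qed

lemma backprop_enclose_carrier:
  assumes "Z \<in> carrier_zono n p"
  shows "backprop_enclose \<phi> Z D \<in> carrier_zono n p"
  using assms by (auto simp: backprop_enclose_def carrier_zono_def)

text \<open>Each entry of the enclosure is built from \<open>slope\<close>, \<open>err_max\<close>,
  \<open>err_min\<close> and one entry of \<open>X\<close> by sums and products. Contracting the
  entry derivatives with \<open>D\<close> and collecting the terms by the function differentiated
  gives the summands of \<open>backprop_enclose_row\<close>.\<close>

lemma has_zderiv_enclose:
  assumes Z: "Z \<in> carrier_zono n p" and diff: "enclose_differentiable \<phi> Z"
    and g: "has_zderiv n (p + n) g (enclose \<phi> Z) D"
  shows "has_zderiv n p (\<lambda>X. g (enclose \<phi> X)) Z (backprop_enclose \<phi> Z D)"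
proof -
  let ?at = "zat n p Z" and ?r = "\<lambda>X. znorm (X - Z)"
  define S where "S i = zgrad (\<lambda>X. slope \<phi> X $ 0) (zproj Z i)" for i
  define U where "U i = zgrad (\<lambda>X. err_max \<phi> X $ 0) (zproj Z i)" for i
  define V where "V i = zgrad (\<lambda>X. err_min \<phi> X $ 0) (zproj Z i)" for i
  \<comment> \<open>Differentiability only asserts that some derivative exists; by uniqueness it is
    \<open>zgrad\<close>.\<close>
  have zgrad: "has_zderiv 1 p f (zproj Z i) (zgrad f (zproj Z i))"
    if "zdifferentiable f (zproj Z i)" for f i
    using that has_zderiv_imp_zgrad_eq[OF _ zproj_carrier[OF Z]] zdifferentiable_iff[OF zproj_carrier[OF Z]]
    by blast
  have "dim_vec (fst Z) = n" using Z by (auto simp: carrier_zono_def)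
  then have S: "has_zderiv 1 p (\<lambda>X. slope \<phi> X $ 0) (zproj Z i) (S i)"
    and U: "has_zderiv 1 p (\<lambda>X. err_max \<phi> X $ 0) (zproj Z i) (U i)"
    and V: "has_zderiv 1 p (\<lambda>X. err_min \<phi> X $ 0) (zproj Z i) (V i)" if "i < n" for i
    using diff that unfolding enclose_differentiable_def S_def U_def V_def by (blast intro: zgrad)+
  \<comment> \<open>The entry is replaced by its value at the \<open>i\<close>-th projection, which
    is legitimate for \<open>X\<close> of the right shape, hence eventually.\<close>
  have slope: "first_order ?at ?r (\<lambda>X. slope \<phi> X $ i) (slope \<phi> Z $ i) (\<lambda>X. zrow p (S i) i (X - Z))"
    if "i < n" for i
    by (rule first_order_cong[OF first_order_zproj[OF S[OF that] Z that]])
       (auto simp: slope_zproj[OF Z that] slope_zproj[OF _ that]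
          intro!: eventually_mono[OF eventually_zat_carrier[of n p]])
  have err_max: "first_order ?at ?r (\<lambda>X. err_max \<phi> X $ i) (err_max \<phi> Z $ i) (\<lambda>X. zrow p (U i) i (X - Z))"
    if "i < n" for i
    by (rule first_order_cong[OF first_order_zproj[OF U[OF that] Z that]])
       (auto simp: err_zproj[OF Z that] err_zproj[OF _ that]
          intro!: eventually_mono[OF eventually_zat_carrier[of n p]])
  have err_min: "first_order ?at ?r (\<lambda>X. err_min \<phi> X $ i) (err_min \<phi> Z $ i) (\<lambda>X. zrow p (V i) i (X - Z))"
    if "i < n" for i
    by (rule first_order_cong[OF first_order_zproj[OF V[OF that] Z that]])
       (auto simp: err_zproj[OF Z that] err_zproj[OF _ that]
          intro!: eventually_mono[OF eventually_zat_carrier[of n p]])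
  \<comment> \<open>\<open>A\<close> and \<open>B\<close> are the derivatives of the entries of the
    enclosure: the product rule for \<open>slope\<close> times center or generator, and the halved
    sum or difference of the error derivatives.\<close>
  define A where "A i X = (fst Z $ i * zrow p (S i) i (X - Z) + slope \<phi> Z $ i * fst (X - Z) $ i) +
      (1/2) * (zrow p (U i) i (X - Z) + zrow p (V i) i (X - Z))" for i X
  define B where "B i j X = (if j < p
      then snd Z $$ (i, j) * zrow p (S i) i (X - Z) + slope \<phi> Z $ i * snd (X - Z) $$ (i, j)
      else if j = p + i then (1/2) * (zrow p (U i) i (X - Z) - zrow p (V i) i (X - Z)) else 0)" for i j X
  show ?thesis
  proof (rule has_zderiv_compose[where F = "enclose \<phi>", OF g enclose_carrier Z])
    show E: "backprop_enclose \<phi> Z D \<in> carrier_zono n p"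
      by (rule backprop_enclose_carrier[OF Z])
    show "first_order ?at ?r (\<lambda>X. fst (enclose \<phi> X) $ i) (fst (enclose \<phi> Z) $ i) (A i)" if i: "i < n" for i
    proof (rule first_order_cong)
      show "first_order ?at ?r
          (\<lambda>X. slope \<phi> X $ i * fst X $ i + (1/2) * (err_max \<phi> X $ i + err_min \<phi> X $ i))
          (slope \<phi> Z $ i * fst Z $ i + (1/2) * (err_max \<phi> Z $ i + err_min \<phi> Z $ i)) (A i)"
        unfolding A_def
        by (intro first_order_add first_order_mult first_order_cmult tendsto_znorm_zat
            slope err_max err_min first_order_fst Z i)
    qed (auto simp: enclose_index(1)[OF Z i] enclose_index(1)[OF _ i]
      intro!: eventually_mono[OF eventually_zat_carrier[of n p]])
    show "first_order ?at ?r (\<lambda>X. snd (enclose \<phi> X) $$ (i, j)) (snd (enclose \<phi> Z) $$ (i, j)) (B i j)"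
      if i: "i < n" and j: "j < p + n" for i j
    proof (rule first_order_cong)
      show "first_order ?at ?r
          (\<lambda>X. if j < p then slope \<phi> X $ i * snd X $$ (i, j)
            else if j = p + i then (1/2) * (err_max \<phi> X $ i - err_min \<phi> X $ i) else 0)
          (if j < p then slope \<phi> Z $ i * snd Z $$ (i, j)
            else if j = p + i then (1/2) * (err_max \<phi> Z $ i - err_min \<phi> Z $ i) else 0) (B i j)"
      proof (cases "j < p")
        case True
        have "first_order ?at ?r (\<lambda>X. slope \<phi> X $ i * snd X $$ (i, j)) (slope \<phi> Z $ i * snd Z $$ (i, j))
          (\<lambda>X. snd Z $$ (i, j) * zrow p (S i) i (X - Z) + slope \<phi> Z $ i * snd (X - Z) $$ (i, j))"
          by (intro first_order_mult tendsto_znorm_zat slope first_order_snd Z i True)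
        then show ?thesis using True by (simp add: B_def[abs_def] del: snd_diff)
      next
        case False
        have "first_order ?at ?r (\<lambda>X. (1/2) * (err_max \<phi> X $ i - err_min \<phi> X $ i))
          ((1/2) * (err_max \<phi> Z $ i - err_min \<phi> Z $ i))
          (\<lambda>X. (1/2) * (zrow p (U i) i (X - Z) - zrow p (V i) i (X - Z)))"
          by (intro first_order_cmult first_order_diff err_max err_min i)
        then show ?thesis using False
          by (cases "j = p + i") (simp_all add: B_def[abs_def] first_order_const)
      qed
    qed (rule eventually_mono[OF eventually_zat_carrier[of n p]],
        erule enclose_index(2)[OF _ i j, symmetric], rule enclose_index(2)[OF Z i j, symmetric], simp)
    show "zinner (backprop_enclose \<phi> Z D) (X - Z) =
        (\<Sum>i<n. fst D $ i * A i X) + (\<Sum>i<n. \<Sum>j<p + n. snd D $$ (i, j) * B i j X)" for X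
    proof -
      have row: "fst (backprop_enclose \<phi> Z D) $ i * fst (X - Z) $ i +
          (\<Sum>j<p. snd (backprop_enclose \<phi> Z D) $$ (i, j) * snd (X - Z) $$ (i, j)) =
          fst D $ i * A i X + (\<Sum>j<p + n. snd D $$ (i, j) * B i j X)" if i: "i < n" for i
      proof -
        \<comment> \<open>The coefficients of the derivatives of \<open>slope\<close>,
          \<open>err_max\<close> and \<open>err_min\<close>. The upper error enters center and
          column \<open>p + i\<close> with factor 1/2 each, the lower one with 1/2 and -1/2; hence
          the signs in \<beta> and \<gamma>.\<close>
        define \<alpha> where "\<alpha> = fst D $ i * fst Z $ i + (\<Sum>j<p. snd D $$ (i, j) * snd Z $$ (i, j))"
        define \<beta> where "\<beta> = (1/2) * (fst D $ i + snd D $$ (i, p + i))"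
        define \<gamma> where "\<gamma> = (1/2) * (fst D $ i - snd D $$ (i, p + i))"
        have car: "S i \<in> carrier_zono 1 p" "U i \<in> carrier_zono 1 p" "V i \<in> carrier_zono 1 p"
          using S U V i by (auto simp: has_zderiv_def)
        have p: "dim_col (snd Z) = p" "dim_vec (fst Z) = n"
          using Z by (auto simp: carrier_zono_def)
        have E: "backprop_enclose_row \<phi> Z D i =
            zscale (slope \<phi> Z $ i) (vec 1 (\<lambda>_. fst D $ i), mat 1 p (\<lambda>(_, j). snd D $$ (i, j)))
            + zscale \<alpha> (S i) + zscale \<beta> (U i) + zscale \<gamma> (V i)"
          using p by (cases Z; cases D)
            (simp add: backprop_enclose_row_def S_def U_def V_def \<alpha>_def \<beta>_def \<gamma>_def Let_def)
        have c: "fst (backprop_enclose \<phi> Z D) $ i = slope \<phi> Z $ i * fst D $ i +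
            \<alpha> * fst (S i) $ 0 + \<beta> * fst (U i) $ 0 + \<gamma> * fst (V i) $ 0"
          using car i by (auto simp: backprop_enclose_def p E zscale_def carrier_zono_def)
        have G: "snd (backprop_enclose \<phi> Z D) $$ (i, j) = slope \<phi> Z $ i * snd D $$ (i, j) +
            \<alpha> * snd (S i) $$ (0, j) + \<beta> * snd (U i) $$ (0, j) + \<gamma> * snd (V i) $$ (0, j)" if "j < p" for j
          using car i that by (auto simp: backprop_enclose_def p E zscale_def carrier_zono_def)
        have "fst (backprop_enclose \<phi> Z D) $ i * fst (X - Z) $ i +
            (\<Sum>j<p. snd (backprop_enclose \<phi> Z D) $$ (i, j) * snd (X - Z) $$ (i, j)) =
            slope \<phi> Z $ i * (fst D $ i * fst (X - Z) $ i + (\<Sum>j<p. snd D $$ (i, j) * snd (X - Z) $$ (i, j)))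
            + \<alpha> * zrow p (S i) i (X - Z) + \<beta> * zrow p (U i) i (X - Z) + \<gamma> * zrow p (V i) i (X - Z)"
          by (simp add: c G zrow_def sum.distrib sum_distrib_left algebra_simps del: fst_diff snd_diff)
        moreover
        \<comment> \<open>The inherited generators contribute slope terms; among the new columns
          only \<open>p + i\<close> contributes to row \<open>i\<close>.\<close>
        have "(\<Sum>j<p + n. snd D $$ (i, j) * B i j X) =
            (\<Sum>j<p. snd D $$ (i, j) * B i j X) + (\<Sum>j\<in>{p..<p + n}. snd D $$ (i, j) * B i j X)"
          by (subst sum.union_disjoint[symmetric]) (auto intro!: sum.cong)
        moreover have "(\<Sum>j<p. snd D $$ (i, j) * B i j X) =
            (\<Sum>j<p. snd D $$ (i, j) * snd Z $$ (i, j)) * zrow p (S i) i (X - Z)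
            + slope \<phi> Z $ i * (\<Sum>j<p. snd D $$ (i, j) * snd (X - Z) $$ (i, j))"
          by (simp add: B_def sum.distrib sum_distrib_left sum_distrib_right algebra_simps del: snd_diff)
        moreover have "(\<Sum>j\<in>{p..<p + n}. snd D $$ (i, j) * B i j X) = (\<Sum>j\<in>{p..<p + n}. if j = p + i
            then snd D $$ (i, p + i) * ((1/2) * (zrow p (U i) i (X - Z) - zrow p (V i) i (X - Z))) else 0)"
          by (intro sum.cong) (auto simp: B_def)
        ultimately show ?thesis
          using i by (simp add: sum.delta A_def \<alpha>_def \<beta>_def \<gamma>_def field_simps del: fst_diff snd_diff)
      qed
      show ?thesis
        unfolding zinner_carrier[OF E] sum.distrib[symmetric] by (intro sum.cong refl row) simp
    qed
  qed
qed

subsection \<open>Backpropagation\<close>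

lemma propagate_refl: "propagate N k k Z = Z"
  by (simp add: propagate_def)

text \<open>Splits off the innermost layer, so that the loss as a function of \<open>H k\<close> is
  the loss as a function of \<open>H (Suc k)\<close> composed with a single layer.\<close>

lemma propagate_Suc: "k < \<kappa> \<Longrightarrow> propagate N k \<kappa> Z = propagate N (Suc k) \<kappa> (layer_forward (N (Suc k)) Z)"
  using upt_conv_Cons[of "Suc k" "Suc \<kappa>"] by (simp add: propagate_def del: upt_Suc)

theorem proposition13:
  fixes \<kappa> :: nat and n :: "nat \<Rightarrow> nat" and p\<^sub>0 :: nat
    and N :: "nat \<Rightarrow> layer"
    and L :: "real vec \<Rightarrow> real vec \<Rightarrow> real" and \<tau> \<epsilon> :: real and t :: "real vec"
    and H :: "nat \<Rightarrow> zonotope" and G :: "nat \<Rightarrow> zonotope"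
  assumes "\<forall>k\<in>{1..\<kappa>}. wf_layer (n (k - 1)) (n k) (N k)"
    and "0 \<le> \<tau>" "\<tau> \<le> 1" "\<epsilon> > 0"
    and "t \<in> carrier_vec (n \<kappa>)"
    and "H 0 \<in> carrier_zono (n 0) p\<^sub>0"
    and "\<forall>k\<in>{1..\<kappa>}. H k = layer_forward (N k) (H (k - 1))"
    and "\<forall>k\<in>{1..\<kappa>}. \<forall>\<phi>. N k = Activation \<phi> \<longrightarrow> enclose_differentiable \<phi> (H (k - 1))"
    and "zdifferentiable (set_loss L \<tau> \<epsilon> t) (H \<kappa>)"
    and "\<forall>k\<le>\<kappa>. G k = zgrad (\<lambda>Z. set_loss L \<tau> \<epsilon> t (propagate N k \<kappa> Z)) (H k)"
  shows "(\<forall>k\<le>\<kappa>. has_zgrad (\<lambda>Z. set_loss L \<tau> \<epsilon> t (propagate N k \<kappa> Z)) (H k) (G k)) \<and>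
    G \<kappa> = zgrad (set_loss L \<tau> \<epsilon> t) (H \<kappa>) \<and>
    (\<forall>k\<in>{1..\<kappa>}. G (k - 1) =
       (case N k of
          Linear W b \<Rightarrow> zlinear (transpose_mat W) (G k)
        | Activation \<phi> \<Rightarrow> backprop_enclose \<phi> (H (k - 1)) (G k)))"
proof -
  let ?E = "set_loss L \<tau> \<epsilon> t"
  let ?f = "\<lambda>k Z. ?E (propagate N k \<kappa> Z)"
  \<comment> \<open>The claimed recursion as an operator on an arbitrary \<open>D\<close>, so that
    the induction can apply it to a derivative not yet identified with \<open>G k\<close>.\<close>
  define pullback where "pullback k D = (case N k of Linear W b \<Rightarrow> zlinear (transpose_mat W) D
    | Activation \<phi> \<Rightarrow> backprop_enclose \<phi> (H (k - 1)) D)" for k D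
  \<comment> \<open>The number of generators depends on the layer, since every enclosure adds some;
    a choice function \<open>p\<close> records it.\<close>
  have "\<exists>p. H k \<in> carrier_zono (n k) p" if "k \<le> \<kappa>" for k
    using that
  proof (induction k)
    case 0
    then show ?case using assms(6) by blast
  next
    case (Suc k)
    then obtain p where p: "H k \<in> carrier_zono (n k) p" by auto
    have "wf_layer (n k) (n (Suc k)) (N (Suc k))" "H (Suc k) = layer_forward (N (Suc k)) (H k)"
      using assms(1,7) Suc.prems by force+
    then show ?case
      by (cases "N (Suc k)") (auto intro: zaffine_carrier[OF _ _ p] enclose_carrier[OF p])
  qed
  then obtain p where "\<forall>k\<le>\<kappa>. H k \<in> carrier_zono (n k) (p k)"
    by metis
  then have H: "H k \<in> carrier_zono (n k) (p k)" if "k \<le> \<kappa>" for k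
    using that by blast
  have layer_step: "has_zderiv (n k) (p k) (?f k) (H k) (pullback (Suc k) D)"
    if k: "k < \<kappa>" and D: "has_zderiv (n (Suc k)) (p (Suc k)) (?f (Suc k)) (H (Suc k)) D" for k D
  proof -
    have wf: "wf_layer (n k) (n (Suc k)) (N (Suc k))" and fwd: "H (Suc k) = layer_forward (N (Suc k)) (H k)"
      and diff: "\<And>\<phi>. N (Suc k) = Activation \<phi> \<Longrightarrow> enclose_differentiable \<phi> (H k)"
      using assms(1,7,8) k by force+
    have Hk: "H k \<in> carrier_zono (n k) (p k)" using H k by simp
    have cols: "dim_col (snd (H (Suc k))) = p (Suc k)"
      using H[of "Suc k"] k by (auto simp: carrier_zono_def)
    show ?thesis
    proof (cases "N (Suc k)")
      case (Linear W b)
      then have Wb: "W \<in> carrier_mat (n (Suc k)) (n k)" "b \<in> carrier_vec (n (Suc k))"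
        using wf by auto
      \<comment> \<open>\<open>p\<close> comes from a choice, so its recursion is recovered by
        counting the columns of \<open>H (Suc k)\<close>.\<close>
      then have "p (Suc k) = p k"
        using zaffine_carrier[OF Wb Hk] fwd cols Linear by (auto simp: carrier_zono_def)
      then show ?thesis
        using has_zderiv_zaffine[OF Wb Hk] D fwd Linear by (simp add: pullback_def propagate_Suc[OF k])
    next
      case (Activation \<phi>)
      then have n: "n (Suc k) = n k" using wf by simp
      then have "p (Suc k) = p k + n k"
        using enclose_carrier[OF Hk, of \<phi>] fwd cols Activation by (auto simp: carrier_zono_def)
      then show ?thesis
        using has_zderiv_enclose[OF Hk diff[OF Activation]] D fwd n Activation
        by (simp add: pullback_def propagate_Suc[OF k])
    qed
  qed
  \<comment> \<open>Downward induction from the output, where the loss is differentiable by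
    assumption.\<close>
  have "\<exists>D. has_zderiv (n k) (p k) (?f k) (H k) D" if "k \<le> \<kappa>" for k
    using that
  proof (induction k rule: inc_induct)
    case base
    show ?case using assms(9) zdifferentiable_iff[OF H] by (simp add: propagate_refl)
  next
    case (step k)
    then show ?case using layer_step by blast
  qed
  then have deriv: "has_zderiv (n k) (p k) (?f k) (H k) (G k)" if "k \<le> \<kappa>" for k
    using that assms(10) has_zderiv_imp_zgrad_eq H by metis
  \<comment> \<open>\<open>layer_step\<close> applied to \<open>G (Suc k)\<close> yields a
    derivative at \<open>H k\<close>; by uniqueness it is \<open>G k\<close>.\<close>
  have "G k = pullback (Suc k) (G (Suc k))" if "k < \<kappa>" for k
    using has_zderiv_imp_zgrad_eq[OF layer_step[OF that deriv] H] that assms(10) by simp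
  then have "G (k - 1) = pullback k (G k)" if "k \<in> {1..\<kappa>}" for k
    using that by (cases k) auto
  moreover have "G \<kappa> = zgrad ?E (H \<kappa>)"
    using assms(10) by (simp add: propagate_refl)
  ultimately show ?thesis
    using has_zderiv_imp_has_zgrad[OF deriv H] unfolding pullback_def by blast
qed

end
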